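(* Let $\mathbf{A}_1,\mathbf{A}_2$ be Stonean residuated lattices and $(h,k)$ a morphism in $\mathfrak{T}$ from $(\mathbf{B}(\mathbf{A}_1),\mathbf{D}(\mathbf{A}_1),\phi_{\mathbf{A}_1})$ to $(\mathbf{B}(\mathbf{A}_2),\mathbf{D}(\mathbf{A}_2),\phi_{\mathbf{A}_2})$. Let $f:A_1\to A_2$ be defined by $f(x)=h(\neg\neg x)\ast k(d)$, where $d\in D(\mathbf{A}_1)$ is any dense element with $x=\neg\neg x\ast d$. Then: (i) $f\restriction_{B(\mathbf{A}_1)}=h$ and $f\restriction_{D(\mathbf{A}_1)}=k$; (ii) $f(\bot)=\bot$, $f(\top)=\top$; (iii) $f(x\wedge y)=f(x)\wedge f(y)$; (iv) $f(x\ast y)=f(x)\ast f(y)$; (v) $f(x\to y)=f(x)\to f(y)$; (vi) $f(x\vee y)=f(x)\vee f(y)$, for all $x,y\in A_1$.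
   Context: A residuated lattice is an algebra $(A,\ast,\to,\vee,\wedge,\top)$ with $(A,\ast,\top)$ a commutative monoid, $(A,\vee,\wedge)$ a lattice with top $\top$, and $x\ast y\le z$ iff $x\le y\to z$. A bounded residuated lattice also has a least element $\bot$; $\neg x:=x\to\bot$. Dense elements: $\neg x=\bot$, forming a residuated lattice $\mathbf{D}(\mathbf{A})$. Boolean elements: $x\vee\neg x=\top$, $x\wedge\neg x=\bot$, forming a Boolean algebra $\mathbf{B}(\mathbf{A})$. Stonean: bounded residuated lattice satisfying $\neg x\vee\neg\neg x=\top$. In a Stonean residuated lattice every $x$ can be written as $x=\neg\neg x\ast d$ with $d$ dense (e.g. $d=\neg\neg x\to x$), and, for $(h,k)$ as in the claim, the element $h(\neg\neg x)\ast k(d)$ does not depend on the choice of such $d$, so $f$ is well defined. i-filters of $\mathbf{D}$: subsets $F\ni\top$ with $x,x\to y\in F\Rightarrow y\in F$; $\mathcal{F}_i(\mathbf{D})$ their lattice. $\phi_{\mathbf{A}}(a)=\{x\in D(\mathbf{A}):x\ge\neg a\}$ for $a\in B(\mathbf{A})$. A morphism in $\mathfrak{T}$ from $(\mathbf{B}_1,\mathbf{D}_1,\phi_1)$ to $(\mathbf{B}_2,\mathbf{D}_2,\phi_2)$ is a pair $(h,k)$ with $h:\mathbf{B}_1\to\mathbf{B}_2$ a Boolean algebra homomorphism, $k:\mathbf{D}_1\to\mathbf{D}_2$ a residuated lattice homomorphism, and $k(\phi_1(a))\subseteq\phi_2(h(a))$ for all $a\in B_1$. *)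

theory Defs
  imports "HOL-Algebra.Group"
begin

record 'a res_lattice = "'a monoid" +
  impl :: "['a, 'a] \<Rightarrow> 'a"  (infixr "\<rightharpoonup>\<index>" 65)
  ljoin :: "['a, 'a] \<Rightarrow> 'a"  (infixl "\<^bold>\<or>\<index>" 67)
  lmeet :: "['a, 'a] \<Rightarrow> 'a"  (infixl "\<^bold>\<and>\<index>" 68)

record 'a bounded_res_lattice = "'a res_lattice" +
  lbot :: 'a  ("\<^bold>\<bottom>\<index>")

record 'a bool_alg = "'a partial_object" +
  bjoin :: "['a, 'a] \<Rightarrow> 'a"
  bmeet :: "['a, 'a] \<Rightarrow> 'a"
  bcompl :: "'a \<Rightarrow> 'a"
  bbot :: 'a
  btop :: 'a

definition lle :: "('a, 'm) res_lattice_scheme \<Rightarrow> 'a \<Rightarrow> 'a \<Rightarrow> bool"  (infixl "\<preceq>\<index>" 50)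
  where "x \<preceq>\<^bsub>A\<^esub> y \<longleftrightarrow> x \<^bold>\<and>\<^bsub>A\<^esub> y = x"

text \<open>The lattice top is the monoid unit \<open>\<one>\<close>.\<close>

locale residuated_lattice = comm_monoid A
  for A :: "('a, 'm) res_lattice_scheme" (structure) +
  assumes impl_closed [simp, intro]: "\<lbrakk>x \<in> carrier A; y \<in> carrier A\<rbrakk> \<Longrightarrow> x \<rightharpoonup> y \<in> carrier A"
    and join_closed [simp, intro]: "\<lbrakk>x \<in> carrier A; y \<in> carrier A\<rbrakk> \<Longrightarrow> x \<^bold>\<or> y \<in> carrier A"
    and meet_closed [simp, intro]: "\<lbrakk>x \<in> carrier A; y \<in> carrier A\<rbrakk> \<Longrightarrow> x \<^bold>\<and> y \<in> carrier A"
    and join_comm: "\<lbrakk>x \<in> carrier A; y \<in> carrier A\<rbrakk> \<Longrightarrow> x \<^bold>\<or> y = y \<^bold>\<or> x"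
    and meet_comm: "\<lbrakk>x \<in> carrier A; y \<in> carrier A\<rbrakk> \<Longrightarrow> x \<^bold>\<and> y = y \<^bold>\<and> x"
    and join_assoc: "\<lbrakk>x \<in> carrier A; y \<in> carrier A; z \<in> carrier A\<rbrakk> \<Longrightarrow> (x \<^bold>\<or> y) \<^bold>\<or> z = x \<^bold>\<or> (y \<^bold>\<or> z)"
    and meet_assoc: "\<lbrakk>x \<in> carrier A; y \<in> carrier A; z \<in> carrier A\<rbrakk> \<Longrightarrow> (x \<^bold>\<and> y) \<^bold>\<and> z = x \<^bold>\<and> (y \<^bold>\<and> z)"
    and join_absorb: "\<lbrakk>x \<in> carrier A; y \<in> carrier A\<rbrakk> \<Longrightarrow> x \<^bold>\<or> (x \<^bold>\<and> y) = x"
    and meet_absorb: "\<lbrakk>x \<in> carrier A; y \<in> carrier A\<rbrakk> \<Longrightarrow> x \<^bold>\<and> (x \<^bold>\<or> y) = x"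
    and le_top: "x \<in> carrier A \<Longrightarrow> x \<preceq> \<one>"
    and residuation: "\<lbrakk>x \<in> carrier A; y \<in> carrier A; z \<in> carrier A\<rbrakk>
      \<Longrightarrow> x \<otimes> y \<preceq> z \<longleftrightarrow> x \<preceq> y \<rightharpoonup> z"

locale bounded_residuated_lattice = residuated_lattice A
  for A :: "('a, 'm) bounded_res_lattice_scheme" (structure) +
  assumes bot_closed [simp, intro]: "\<^bold>\<bottom> \<in> carrier A"
    and bot_le: "x \<in> carrier A \<Longrightarrow> \<^bold>\<bottom> \<preceq> x"

definition lneg :: "('a, 'm) bounded_res_lattice_scheme \<Rightarrow> 'a \<Rightarrow> 'a"  ("\<sim>\<index> _" [81] 80)
  where "\<sim>\<^bsub>A\<^esub> x = x \<rightharpoonup>\<^bsub>A\<^esub> \<^bold>\<bottom>\<^bsub>A\<^esub>"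

locale stonean_residuated_lattice = bounded_residuated_lattice A
  for A :: "('a, 'm) bounded_res_lattice_scheme" (structure) +
  assumes stone: "x \<in> carrier A \<Longrightarrow> \<sim> x \<^bold>\<or> \<sim> (\<sim> x) = \<one>"

definition dense_algebra :: "('a, 'm) bounded_res_lattice_scheme \<Rightarrow> 'a res_lattice"
  where "dense_algebra A =
    \<lparr>carrier = {x \<in> carrier A. \<sim>\<^bsub>A\<^esub> x = \<^bold>\<bottom>\<^bsub>A\<^esub>}, mult = mult A, one = one A,
     impl = impl A, ljoin = ljoin A, lmeet = lmeet A\<rparr>"

definition boolean_algebra_of :: "('a, 'm) bounded_res_lattice_scheme \<Rightarrow> 'a bool_alg"
  where "boolean_algebra_of A =
    \<lparr>carrier = {x \<in> carrier A. x \<^bold>\<or>\<^bsub>A\<^esub> \<sim>\<^bsub>A\<^esub> x = \<one>\<^bsub>A\<^esub> \<and> x \<^bold>\<and>\<^bsub>A\<^esub> \<sim>\<^bsub>A\<^esub> x = \<^bold>\<bottom>\<^bsub>A\<^esub>},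
     bjoin = ljoin A, bmeet = lmeet A, bcompl = lneg A, bbot = lbot A, btop = one A\<rparr>"

definition res_lattice_hom ::
    "('a, 'm) res_lattice_scheme \<Rightarrow> ('b, 'n) res_lattice_scheme \<Rightarrow> ('a \<Rightarrow> 'b) set"
  where "res_lattice_hom D E = {k \<in> carrier D \<rightarrow> carrier E.
    k \<one>\<^bsub>D\<^esub> = \<one>\<^bsub>E\<^esub> \<and>
    (\<forall>x\<in>carrier D. \<forall>y\<in>carrier D.
      k (x \<otimes>\<^bsub>D\<^esub> y) = k x \<otimes>\<^bsub>E\<^esub> k y \<and>
      k (x \<rightharpoonup>\<^bsub>D\<^esub> y) = k x \<rightharpoonup>\<^bsub>E\<^esub> k y \<and>
      k (x \<^bold>\<or>\<^bsub>D\<^esub> y) = k x \<^bold>\<or>\<^bsub>E\<^esub> k y \<and>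
      k (x \<^bold>\<and>\<^bsub>D\<^esub> y) = k x \<^bold>\<and>\<^bsub>E\<^esub> k y)}"

definition bool_alg_hom ::
    "('a, 'm) bool_alg_scheme \<Rightarrow> ('b, 'n) bool_alg_scheme \<Rightarrow> ('a \<Rightarrow> 'b) set"
  where "bool_alg_hom B C = {h \<in> carrier B \<rightarrow> carrier C.
    h (bbot B) = bbot C \<and> h (btop B) = btop C \<and>
    (\<forall>x\<in>carrier B. h (bcompl B x) = bcompl C (h x)) \<and>
    (\<forall>x\<in>carrier B. \<forall>y\<in>carrier B.
      h (bjoin B x y) = bjoin C (h x) (h y) \<and>
      h (bmeet B x y) = bmeet C (h x) (h y))}"

definition phi :: "('a, 'm) bounded_res_lattice_scheme \<Rightarrow> 'a \<Rightarrow> 'a set"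
  where "phi A a = {x \<in> carrier (dense_algebra A). \<sim>\<^bsub>A\<^esub> a \<preceq>\<^bsub>A\<^esub> x}"

type_synonym ('b, 'd) triple = "'b bool_alg \<times> 'd res_lattice \<times> ('b \<Rightarrow> 'd set)"

definition triple_of :: "('a, 'm) bounded_res_lattice_scheme \<Rightarrow> ('a, 'a) triple"
  where "triple_of A = (boolean_algebra_of A, dense_algebra A, phi A)"

fun triple_hom :: "('b1, 'd1) triple \<Rightarrow> ('b2, 'd2) triple \<Rightarrow> (('b1 \<Rightarrow> 'b2) \<times> ('d1 \<Rightarrow> 'd2)) set"
  where "triple_hom (B1, D1, \<phi>1) (B2, D2, \<phi>2) =
    {(h, k). h \<in> bool_alg_hom B1 B2 \<and> k \<in> res_lattice_hom D1 D2 \<and>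
      (\<forall>a\<in>carrier B1. k ` \<phi>1 a \<subseteq> \<phi>2 (h a))}"

text \<open>Existence and uniqueness of the described value, for Stonean \<open>A1\<close>, \<open>A2\<close> and a morphism
  \<open>(h, k)\<close>, is \<open>triple_hom_lift_eq\<close> below together with \<open>dense_decomposition\<close>.\<close>

definition triple_hom_lift ::
    "('a, 'm) bounded_res_lattice_scheme \<Rightarrow> ('b, 'n) bounded_res_lattice_scheme \<Rightarrow>
      ('a \<Rightarrow> 'b) \<Rightarrow> ('a \<Rightarrow> 'b) \<Rightarrow> 'a \<Rightarrow> 'b"
  where "triple_hom_lift A1 A2 h k x =
    (THE y. \<exists>d\<in>carrier (dense_algebra A1).
      x = \<sim>\<^bsub>A1\<^esub> (\<sim>\<^bsub>A1\<^esub> x) \<otimes>\<^bsub>A1\<^esub> d \<and> y = h (\<sim>\<^bsub>A1\<^esub> (\<sim>\<^bsub>A1\<^esub> x)) \<otimes>\<^bsub>A2\<^esub> k d)"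

context residuated_lattice
begin

lemma le_refl: "x \<in> carrier A \<Longrightarrow> x \<preceq> x"
  by (metis join_absorb lle_def meet_absorb meet_closed)

lemma le_antisym: "\<lbrakk>x \<preceq> y; y \<preceq> x; x \<in> carrier A; y \<in> carrier A\<rbrakk> \<Longrightarrow> x = y"
  by (metis lle_def meet_comm)

lemma le_trans: "\<lbrakk>x \<preceq> y; y \<preceq> z; x \<in> carrier A; y \<in> carrier A; z \<in> carrier A\<rbrakk> \<Longrightarrow> x \<preceq> z"
  by (metis lle_def meet_assoc)

lemma le_join1: "\<lbrakk>x \<in> carrier A; y \<in> carrier A\<rbrakk> \<Longrightarrow> x \<preceq> x \<^bold>\<or> y"
  by (simp add: lle_def meet_absorb)

lemma le_join2: "\<lbrakk>x \<in> carrier A; y \<in> carrier A\<rbrakk> \<Longrightarrow> y \<preceq> x \<^bold>\<or> y"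
  by (metis le_join1 join_comm)

lemma le_iff_join: "\<lbrakk>x \<in> carrier A; y \<in> carrier A\<rbrakk> \<Longrightarrow> x \<preceq> y \<longleftrightarrow> x \<^bold>\<or> y = y"
  by (metis join_absorb join_comm lle_def meet_absorb meet_comm)

lemma join_le: "\<lbrakk>x \<preceq> z; y \<preceq> z; x \<in> carrier A; y \<in> carrier A; z \<in> carrier A\<rbrakk> \<Longrightarrow> x \<^bold>\<or> y \<preceq> z"
  by (metis join_assoc join_closed le_iff_join)

lemma meet_le1: "\<lbrakk>x \<in> carrier A; y \<in> carrier A\<rbrakk> \<Longrightarrow> x \<^bold>\<and> y \<preceq> x"
  by (metis join_absorb join_comm le_iff_join meet_closed)

lemma meet_le2: "\<lbrakk>x \<in> carrier A; y \<in> carrier A\<rbrakk> \<Longrightarrow> x \<^bold>\<and> y \<preceq> y"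
  by (metis meet_le1 meet_comm)

lemma le_meet: "\<lbrakk>z \<preceq> x; z \<preceq> y; x \<in> carrier A; y \<in> carrier A; z \<in> carrier A\<rbrakk> \<Longrightarrow> z \<preceq> x \<^bold>\<and> y"
  by (metis lle_def meet_assoc)

lemma mult_mono1: "\<lbrakk>x \<preceq> y; x \<in> carrier A; y \<in> carrier A; z \<in> carrier A\<rbrakk> \<Longrightarrow> x \<otimes> z \<preceq> y \<otimes> z"
  by (metis impl_closed le_refl le_trans m_closed residuation)

lemma mult_mono2: "\<lbrakk>x \<preceq> y; x \<in> carrier A; y \<in> carrier A; z \<in> carrier A\<rbrakk> \<Longrightarrow> z \<otimes> x \<preceq> z \<otimes> y"
  by (metis m_comm mult_mono1)

lemma mult_le2: "\<lbrakk>x \<in> carrier A; y \<in> carrier A\<rbrakk> \<Longrightarrow> x \<otimes> y \<preceq> y"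
  by (metis l_one le_top mult_mono1 one_closed)

lemma mult_le1: "\<lbrakk>x \<in> carrier A; y \<in> carrier A\<rbrakk> \<Longrightarrow> x \<otimes> y \<preceq> x"
  by (metis m_comm mult_le2)

lemma modus_ponens: "\<lbrakk>x \<in> carrier A; y \<in> carrier A\<rbrakk> \<Longrightarrow> (x \<rightharpoonup> y) \<otimes> x \<preceq> y"
  by (simp add: le_refl residuation)

lemma mult_join_le:
  assumes "x \<in> carrier A" "y \<in> carrier A" "z \<in> carrier A" "w \<in> carrier A"
    and "x \<otimes> z \<preceq> w" "y \<otimes> z \<preceq> w"
  shows "(x \<^bold>\<or> y) \<otimes> z \<preceq> w"
  using assms by (simp add: residuation join_le)

end

context bounded_residuated_lattice
begin

lemma neg_closed [simp, intro]: "x \<in> carrier A \<Longrightarrow> \<sim> x \<in> carrier A"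
  by (simp add: lneg_def)

lemma neg_mult: "x \<in> carrier A \<Longrightarrow> \<sim> x \<otimes> x = \<^bold>\<bottom>"
  by (metis bot_closed bot_le le_antisym lneg_def m_closed modus_ponens neg_closed)

lemma le_neg_iff: "\<lbrakk>x \<in> carrier A; y \<in> carrier A\<rbrakk> \<Longrightarrow> x \<preceq> \<sim> y \<longleftrightarrow> x \<otimes> y \<preceq> \<^bold>\<bottom>"
  by (simp add: lneg_def residuation)

lemma le_neg_neg: "x \<in> carrier A \<Longrightarrow> x \<preceq> \<sim> (\<sim> x)"
  by (metis bot_closed le_neg_iff le_refl m_comm neg_closed neg_mult)

lemma neg_antimono: "\<lbrakk>x \<preceq> y; x \<in> carrier A; y \<in> carrier A\<rbrakk> \<Longrightarrow> \<sim> y \<preceq> \<sim> x"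
  by (metis le_neg_iff mult_mono2 neg_closed neg_mult)

lemma neg_neg_neg: "x \<in> carrier A \<Longrightarrow> \<sim> (\<sim> (\<sim> x)) = \<sim> x"
  by (meson le_antisym le_neg_neg neg_antimono neg_closed)

lemma dense_carrier: "x \<in> carrier (dense_algebra A) \<longleftrightarrow> x \<in> carrier A \<and> \<sim> x = \<^bold>\<bottom>"
  by (simp add: dense_algebra_def)

lemma boolean_carrier:
  "x \<in> carrier (boolean_algebra_of A) \<longleftrightarrow>
    x \<in> carrier A \<and> x \<^bold>\<or> \<sim> x = \<one> \<and> x \<^bold>\<and> \<sim> x = \<^bold>\<bottom>"
  by (simp add: boolean_algebra_of_def)

lemma dense_up:
  assumes "x \<in> carrier (dense_algebra A)" "x \<preceq> y" "y \<in> carrier A"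
  shows "y \<in> carrier (dense_algebra A)"
  using assms by (metis bot_closed bot_le dense_carrier le_antisym neg_antimono neg_closed)

lemma dense_mult:
  assumes "x \<in> carrier (dense_algebra A)" "y \<in> carrier (dense_algebra A)"
  shows "x \<otimes> y \<in> carrier (dense_algebra A)"
proof -
  have c: "x \<in> carrier A" "y \<in> carrier A" "\<sim> x = \<^bold>\<bottom>" "\<sim> y = \<^bold>\<bottom>"
    using assms by (auto simp: dense_carrier)
  let ?n = "\<sim> (x \<otimes> y)"
  have "(?n \<otimes> x) \<otimes> y = \<^bold>\<bottom>" using c by (simp add: m_assoc neg_mult)
  then have "?n \<otimes> x \<preceq> \<sim> y"
    by (metis c(1,2) bot_closed le_neg_iff le_refl m_closed neg_closed)
  then have "?n \<preceq> \<sim> x"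
    by (metis c le_neg_iff m_closed neg_closed)
  then have "?n = \<^bold>\<bottom>" using c by (simp add: bot_le le_antisym)
  then show ?thesis using c by (simp add: dense_carrier)
qed

lemma dense_algebra_residuated_lattice: "residuated_lattice (dense_algebra A)"
proof -
  let ?D = "carrier (dense_algebra A)"
  have sub: "x \<in> carrier A" if "x \<in> ?D" for x using that by (simp add: dense_carrier)
  have one: "\<one> \<in> ?D"
    by (metis dense_carrier neg_closed neg_mult one_closed r_one)
  have imp: "x \<rightharpoonup> y \<in> ?D" if "x \<in> ?D" "y \<in> ?D" for x y
  proof (rule dense_up[OF that(2)])
    show "y \<preceq> x \<rightharpoonup> y"
      using that sub mult_le1 residuation by blast
  qed (use that sub in auto)
  have jo: "x \<^bold>\<or> y \<in> ?D" if "x \<in> ?D" "y \<in> ?D" for x y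
    using that sub by (meson dense_up join_closed le_join1)
  have me: "x \<^bold>\<and> y \<in> ?D" if "x \<in> ?D" "y \<in> ?D" for x y
  proof (rule dense_up[OF dense_mult[OF that]])
    show "x \<otimes> y \<preceq> x \<^bold>\<and> y"
      using that sub by (simp add: le_meet mult_le1 mult_le2)
  qed (use that sub in auto)
  have ops: "mult (dense_algebra A) = mult A" "one (dense_algebra A) = one A"
    "impl (dense_algebra A) = impl A" "ljoin (dense_algebra A) = ljoin A"
    "lmeet (dense_algebra A) = lmeet A" "lle (dense_algebra A) = lle A"
    by (auto simp: dense_algebra_def lle_def fun_eq_iff)
  show ?thesis
    by unfold_locales
      (auto simp: ops one imp jo me dense_mult sub m_assoc
        join_assoc meet_assoc join_absorb meet_absorb le_top residuation
        intro: m_comm join_comm meet_comm)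
qed

lemma boolean_idem:
  assumes "b \<in> carrier (boolean_algebra_of A)"
  shows "b \<otimes> b = b"
proof -
  have c: "b \<in> carrier A" "b \<^bold>\<or> \<sim> b = \<one>" using assms by (auto simp: boolean_carrier)
  have "(b \<^bold>\<or> \<sim> b) \<otimes> b \<preceq> b \<otimes> b"
    using c(1) by (intro mult_join_le) (auto simp: le_refl neg_mult bot_le)
  then show ?thesis using c by (simp add: le_antisym mult_le1)
qed

lemma boolean_neg_neg:
  assumes "b \<in> carrier (boolean_algebra_of A)"
  shows "\<sim> (\<sim> b) = b"
proof -
  have c: "b \<in> carrier A" "b \<^bold>\<or> \<sim> b = \<one>" using assms by (auto simp: boolean_carrier)
  have "\<sim> b \<otimes> \<sim> (\<sim> b) = \<^bold>\<bottom>" using c by (metis m_comm neg_closed neg_mult)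
  then have "(b \<^bold>\<or> \<sim> b) \<otimes> \<sim> (\<sim> b) \<preceq> b"
    using c(1) by (intro mult_join_le) (auto simp: mult_le1 bot_le)
  then show ?thesis using c by (simp add: le_antisym le_neg_neg)
qed

lemma boolean_neg:
  assumes "b \<in> carrier (boolean_algebra_of A)"
  shows "\<sim> b \<in> carrier (boolean_algebra_of A)"
  using assms boolean_neg_neg[OF assms] by (auto simp: boolean_carrier join_comm meet_comm)

end

context stonean_residuated_lattice
begin

lemma boolean_neg_neg_closed:
  assumes x: "x \<in> carrier A"
  shows "\<sim> (\<sim> x) \<in> carrier (boolean_algebra_of A)"
proof -
  let ?b = "\<sim> x" and ?c = "\<sim> (\<sim> x)"
  let ?m = "?c \<^bold>\<and> ?b"
  have cl: "?b \<in> carrier A" "?c \<in> carrier A" "?m \<in> carrier A" using x by auto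
  have bc: "?b \<otimes> ?c = \<^bold>\<bottom>" using cl by (metis m_comm neg_mult)
  have "?b \<otimes> ?m \<preceq> \<^bold>\<bottom>" using cl bc by (metis meet_le1 mult_mono2)
  moreover have "?c \<otimes> ?m \<preceq> \<^bold>\<bottom>" using cl by (metis meet_le2 mult_mono2 neg_mult)
  ultimately have "(?b \<^bold>\<or> ?c) \<otimes> ?m \<preceq> \<^bold>\<bottom>" using cl by (intro mult_join_le) auto
  then have "?m = \<^bold>\<bottom>" using cl x by (simp add: stone bot_le le_antisym)
  then show ?thesis
    using cl x by (simp add: boolean_carrier neg_neg_neg join_comm stone)
qed

lemma dense_decomposition:
  assumes x: "x \<in> carrier A"
  shows "\<sim> (\<sim> x) \<rightharpoonup> x \<in> carrier (dense_algebra A)"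
    and "x = \<sim> (\<sim> x) \<otimes> (\<sim> (\<sim> x) \<rightharpoonup> x)"
proof -
  let ?b = "\<sim> (\<sim> x)"
  let ?d = "?b \<rightharpoonup> x"
  have c: "?b \<in> carrier A" "?d \<in> carrier A" "\<sim> x \<in> carrier A" using x by auto
  have b: "?b \<in> carrier (boolean_algebra_of A)" using x by (rule boolean_neg_neg_closed)
  have xd: "x \<preceq> ?d" using c x mult_le1 residuation by blast
  have "\<sim> x \<otimes> ?b \<preceq> x" using c x by (metis bot_le m_comm neg_mult)
  then have nd: "\<sim> x \<preceq> ?d" using c x by (simp add: residuation)
  have "\<sim> ?d \<preceq> \<sim> x" "\<sim> ?d \<preceq> ?b" using c x xd nd by (auto intro: neg_antimono)
  then have "\<sim> ?d \<preceq> ?b \<^bold>\<and> \<sim> x" using c by (simp add: le_meet)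
  also have "?b \<^bold>\<and> \<sim> x = \<^bold>\<bottom>" using b x by (simp add: boolean_carrier neg_neg_neg)
  finally have "\<sim> ?d = \<^bold>\<bottom>" using c by (simp add: bot_le le_antisym)
  then show "?d \<in> carrier (dense_algebra A)" using c by (simp add: dense_carrier)
  have "(?b \<^bold>\<or> \<sim> x) \<otimes> x \<preceq> ?b \<otimes> ?d"
    using c x xd by (intro mult_join_le) (auto simp: mult_mono2 neg_mult bot_le)
  then have "x \<preceq> ?b \<otimes> ?d" using c x by (metis join_comm l_one stone)
  moreover have "?b \<otimes> ?d \<preceq> x" using c x by (metis m_comm modus_ponens)
  ultimately show "x = ?b \<otimes> ?d" using c x by (simp add: le_antisym)
qed

end

lemma triple_hom_lift_eq:
  assumes A1: "stonean_residuated_lattice A1" and A2: "stonean_residuated_lattice A2"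
    and hk: "(h, k) \<in> triple_hom (triple_of A1) (triple_of A2)"
    and x: "x \<in> carrier A1" and d: "d \<in> carrier (dense_algebra A1)"
    and xd: "x = \<sim>\<^bsub>A1\<^esub> (\<sim>\<^bsub>A1\<^esub> x) \<otimes>\<^bsub>A1\<^esub> d"
  shows "triple_hom_lift A1 A2 h k x = h (\<sim>\<^bsub>A1\<^esub> (\<sim>\<^bsub>A1\<^esub> x)) \<otimes>\<^bsub>A2\<^esub> k d"
proof -
  interpret a: stonean_residuated_lattice A1 by (rule A1)
  interpret b: stonean_residuated_lattice A2 by (rule A2)
  have h: "h \<in> bool_alg_hom (boolean_algebra_of A1) (boolean_algebra_of A2)"
    and k: "k \<in> res_lattice_hom (dense_algebra A1) (dense_algebra A2)"
    and p: "\<And>a. a \<in> carrier (boolean_algebra_of A1) \<Longrightarrow> k ` phi A1 a \<subseteq> phi A2 (h a)"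
    using hk by (auto simp: triple_of_def)
  let ?b = "\<sim>\<^bsub>A1\<^esub> (\<sim>\<^bsub>A1\<^esub> x)"
  have bB: "?b \<in> carrier (boolean_algebra_of A1)" using x by (rule a.boolean_neg_neg_closed)
  have b: "?b \<in> carrier A1" using x by auto
  have hB: "h ?b \<in> carrier (boolean_algebra_of A2)"
    using h bB by (auto simp: bool_alg_hom_def)
  then have hc: "h ?b \<in> carrier A2" by (simp add: b.boolean_carrier)
  have hneg: "h (\<sim>\<^bsub>A1\<^esub> ?b) = \<sim>\<^bsub>A2\<^esub> (h ?b)"
    using h bB by (simp add: bool_alg_hom_def boolean_algebra_of_def)
  have kD: "k e \<in> carrier (dense_algebra A2)" if "e \<in> carrier (dense_algebra A1)" for e
    using k that by (auto simp: res_lattice_hom_def)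
  have le: "h ?b \<otimes>\<^bsub>A2\<^esub> k e \<preceq>\<^bsub>A2\<^esub> h ?b \<otimes>\<^bsub>A2\<^esub> k e'"
    if e: "e \<in> carrier (dense_algebra A1)" and e': "e' \<in> carrier (dense_algebra A1)"
      and eq: "?b \<otimes>\<^bsub>A1\<^esub> e = ?b \<otimes>\<^bsub>A1\<^esub> e'" for e e'
  proof -
    have c: "e \<in> carrier A1" "e' \<in> carrier A1" using e e' by (auto simp: a.dense_carrier)
    have kc: "k e \<in> carrier A2" "k e' \<in> carrier A2"
      using kD[OF e] kD[OF e'] by (auto simp: b.dense_carrier)
    have D: "e \<rightharpoonup>\<^bsub>A1\<^esub> e' \<in> carrier (dense_algebra A1)"
      using a.dense_up[OF e', of "e \<rightharpoonup>\<^bsub>A1\<^esub> e'"] c a.mult_le1 a.residuation by blast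
    have "?b \<otimes>\<^bsub>A1\<^esub> e \<preceq>\<^bsub>A1\<^esub> e'" using eq c b by (simp add: a.mult_le2)
    then have "?b \<preceq>\<^bsub>A1\<^esub> e \<rightharpoonup>\<^bsub>A1\<^esub> e'" using b c a.residuation by blast
    then have "e \<rightharpoonup>\<^bsub>A1\<^esub> e' \<in> phi A1 (\<sim>\<^bsub>A1\<^esub> ?b)"
      using D bB by (simp add: phi_def a.boolean_neg_neg)
    then have "k (e \<rightharpoonup>\<^bsub>A1\<^esub> e') \<in> phi A2 (h (\<sim>\<^bsub>A1\<^esub> ?b))"
      using p[OF a.boolean_neg[OF bB]] by blast
    moreover have "k (e \<rightharpoonup>\<^bsub>A1\<^esub> e') = k e \<rightharpoonup>\<^bsub>A2\<^esub> k e'"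
      using k e e' by (simp add: res_lattice_hom_def dense_algebra_def)
    ultimately have "h ?b \<preceq>\<^bsub>A2\<^esub> k e \<rightharpoonup>\<^bsub>A2\<^esub> k e'"
      using hB by (simp add: phi_def hneg b.boolean_neg_neg)
    then have "h ?b \<otimes>\<^bsub>A2\<^esub> k e \<preceq>\<^bsub>A2\<^esub> k e'" using hc kc b.residuation by blast
    then have "h ?b \<otimes>\<^bsub>A2\<^esub> (h ?b \<otimes>\<^bsub>A2\<^esub> k e) \<preceq>\<^bsub>A2\<^esub> h ?b \<otimes>\<^bsub>A2\<^esub> k e'"
      using hc kc by (intro b.mult_mono2) auto
    then show ?thesis
      using hc kc hB by (simp add: b.m_assoc[symmetric] b.boolean_idem)
  qed
  have uniq: "h ?b \<otimes>\<^bsub>A2\<^esub> k e = h ?b \<otimes>\<^bsub>A2\<^esub> k d"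
    if "e \<in> carrier (dense_algebra A1)" "x = ?b \<otimes>\<^bsub>A1\<^esub> e" for e
  proof (rule b.le_antisym)
    have "?b \<otimes>\<^bsub>A1\<^esub> e = ?b \<otimes>\<^bsub>A1\<^esub> d" using xd that(2) by simp
    then show "h ?b \<otimes>\<^bsub>A2\<^esub> k e \<preceq>\<^bsub>A2\<^esub> h ?b \<otimes>\<^bsub>A2\<^esub> k d"
      and "h ?b \<otimes>\<^bsub>A2\<^esub> k d \<preceq>\<^bsub>A2\<^esub> h ?b \<otimes>\<^bsub>A2\<^esub> k e"
      using le[OF that(1) d] le[OF d that(1)] by simp_all
  qed (use hc kD[OF that(1)] kD[OF d] in \<open>auto simp: b.dense_carrier\<close>)
  show ?thesis
    unfolding triple_hom_lift_def
  proof (rule the_equality)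
    show "\<exists>e\<in>carrier (dense_algebra A1). x = ?b \<otimes>\<^bsub>A1\<^esub> e \<and>
        h ?b \<otimes>\<^bsub>A2\<^esub> k d = h ?b \<otimes>\<^bsub>A2\<^esub> k e"
      using d xd by blast
  qed (use uniq in blast)
qed

end

theory Submission
  imports Defs
begin

text \<open>
  Boolean elements \<open>p\<close> act as localizations: the value of \<open>x \<^bold>\<and> y\<close>, \<open>x \<rightharpoonup> y\<close> or \<open>x \<^bold>\<or> y\<close> after
  multiplication by \<open>p\<close> depends only on \<open>p \<otimes> x\<close> and \<open>p \<otimes> y\<close>, and an element is determined by its
  localizations at \<open>p\<close> and \<open>\<sim> p\<close>.  Since \<open>\<sim> \<sim> (b \<otimes> d) = b\<close> for \<open>b\<close> Boolean and \<open>d\<close> dense, the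
  map \<open>f\<close> sends \<open>b \<otimes> d\<close> to \<open>h b \<otimes> k d\<close> and is therefore multiplicative.  Splitting along
  \<open>\<sim> \<sim> x\<close> and \<open>\<sim> \<sim> y\<close>, on each of the four pieces \<open>x\<close> and \<open>y\<close> agree with elements that are dense
  or \<open>\<^bold>\<bottom>\<close>, and on those \<open>f\<close> is compatible with the other operations because \<open>k\<close> is a homomorphism.
\<close>

lemma boolean_algebra_of_ops:
  "bmeet (boolean_algebra_of A) = lmeet A" "bcompl (boolean_algebra_of A) = lneg A"
  "bbot (boolean_algebra_of A) = lbot A" "btop (boolean_algebra_of A) = one A"
  by (simp_all add: boolean_algebra_of_def)

lemma dense_algebra_ops:
  "mult (dense_algebra A) = mult A" "one (dense_algebra A) = one A"
  "impl (dense_algebra A) = impl A" "ljoin (dense_algebra A) = ljoin A"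
  "lmeet (dense_algebra A) = lmeet A"
  by (simp_all add: dense_algebra_def)

section \<open>Localization at Boolean elements\<close>

context bounded_residuated_lattice
begin

text \<open>Each Boolean \<open>p\<close> induces the equivalence
  \<open>p \<otimes> x = p \<otimes> x'\<close>; the second conjunct is compatibility of
  \<open>g\<close> with all of these. Abstracting over \<open>g\<close> lets meet, join and
  implication share one lifting argument.\<close>

definition boolean_local :: "('a \<Rightarrow> 'a \<Rightarrow> 'a) \<Rightarrow> bool"
  where "boolean_local g \<longleftrightarrow>
    (\<forall>x\<in>carrier A. \<forall>y\<in>carrier A. g x y \<in> carrier A) \<and>
    (\<forall>p\<in>carrier (boolean_algebra_of A). \<forall>x\<in>carrier A. \<forall>y\<in>carrier A.
      \<forall>x'\<in>carrier A. \<forall>y'\<in>carrier A.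
      p \<otimes> x = p \<otimes> x' \<longrightarrow> p \<otimes> y = p \<otimes> y' \<longrightarrow> p \<otimes> g x y = p \<otimes> g x' y')"

lemma boolean_closed [simp]: "b \<in> carrier (boolean_algebra_of A) \<Longrightarrow> b \<in> carrier A"
  by (simp add: boolean_carrier)

lemma dense_closed [simp]: "d \<in> carrier (dense_algebra A) \<Longrightarrow> d \<in> carrier A"
  by (simp add: dense_carrier)

lemma bot_mult [simp]: "x \<in> carrier A \<Longrightarrow> \<^bold>\<bottom> \<otimes> x = \<^bold>\<bottom>"
  by (simp add: bot_le le_antisym mult_le1)

lemma mult_bot [simp]: "x \<in> carrier A \<Longrightarrow> x \<otimes> \<^bold>\<bottom> = \<^bold>\<bottom>"
  by (simp add: bot_le le_antisym mult_le2)

lemma bot_impl [simp]: "x \<in> carrier A \<Longrightarrow> \<^bold>\<bottom> \<rightharpoonup> x = \<one>"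
  by (metis bot_closed bot_le bot_mult impl_closed le_antisym le_top m_comm one_closed residuation)

lemma bot_meet [simp]: "x \<in> carrier A \<Longrightarrow> \<^bold>\<bottom> \<^bold>\<and> x = \<^bold>\<bottom>"
  using bot_le by (simp add: lle_def)

lemma meet_bot [simp]: "x \<in> carrier A \<Longrightarrow> x \<^bold>\<and> \<^bold>\<bottom> = \<^bold>\<bottom>"
  by (metis bot_closed bot_meet meet_comm)

lemma bot_join [simp]: "x \<in> carrier A \<Longrightarrow> \<^bold>\<bottom> \<^bold>\<or> x = x"
  using bot_le le_iff_join by simp

lemma join_bot [simp]: "x \<in> carrier A \<Longrightarrow> x \<^bold>\<or> \<^bold>\<bottom> = x"
  by (metis bot_closed bot_join join_comm)

lemma bot_boolean [simp]: "\<^bold>\<bottom> \<in> carrier (boolean_algebra_of A)"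
  by (simp add: boolean_carrier lneg_def)

lemma neg_one: "\<sim> \<one> = \<^bold>\<bottom>"
  by (metis neg_closed neg_mult one_closed r_one)

lemma one_dense [simp]: "\<one> \<in> carrier (dense_algebra A)"
  by (simp add: dense_carrier neg_one)

lemma neg_dense: "d \<in> carrier (dense_algebra A) \<Longrightarrow> d \<rightharpoonup> \<^bold>\<bottom> = \<^bold>\<bottom>"
  by (simp add: dense_carrier lneg_def)

text \<open>The meet of \<open>b\<close> and \<open>u\<close> is split along the join of
  \<open>b\<close> and \<open>\<sim> b\<close>, which is \<open>\<one>\<close>: its product with
  \<open>b\<close> is below \<open>b \<otimes> u\<close>, and its product with
  \<open>\<sim> b\<close> is below \<open>\<sim> b \<otimes> b\<close>, which is bottom.\<close>

lemma boolean_mult_eq_meet: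
  assumes b: "b \<in> carrier (boolean_algebra_of A)" and u: "u \<in> carrier A"
  shows "b \<otimes> u = b \<^bold>\<and> u"
proof (rule le_antisym)
  show "b \<otimes> u \<preceq> b \<^bold>\<and> u"
    using b u by (simp add: le_meet mult_le1 mult_le2)
  have "b \<otimes> (b \<^bold>\<and> u) \<preceq> b \<otimes> u"
    using b u by (simp add: meet_le2 mult_mono2)
  moreover have "\<sim> b \<otimes> (b \<^bold>\<and> u) \<preceq> \<sim> b \<otimes> b"
    using b u by (simp add: meet_le1 mult_mono2)
  then have "\<sim> b \<otimes> (b \<^bold>\<and> u) \<preceq> b \<otimes> u"
    using b u by (simp add: neg_mult le_trans[OF _ bot_le])
  ultimately have "(b \<^bold>\<or> \<sim> b) \<otimes> (b \<^bold>\<and> u) \<preceq> b \<otimes> u"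
    using b u by (intro mult_join_le) auto
  then show "b \<^bold>\<and> u \<preceq> b \<otimes> u"
    using b u by (simp add: boolean_carrier)
qed (use b u in auto)

text \<open>Since \<open>p \<otimes> u\<close> is below \<open>p\<close> anyway, a bound by
  \<open>v\<close> is a bound by the meet of \<open>p\<close> and \<open>v\<close>, which is
  \<open>p \<otimes> v\<close>.\<close>

lemma boolean_mult_eqI:
  assumes p: "p \<in> carrier (boolean_algebra_of A)" and u: "u \<in> carrier A" and v: "v \<in> carrier A"
    and le: "p \<otimes> u \<preceq> v" "p \<otimes> v \<preceq> u"
  shows "p \<otimes> u = p \<otimes> v"
  using assms by (intro le_antisym) (simp_all add: boolean_mult_eq_meet le_meet meet_le1)

text \<open>The join of \<open>p\<close> and \<open>\<sim> p\<close> is the unit, so an element lies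
  below \<open>t\<close> once both its localizations do; these equal \<open>p \<otimes> t\<close>
  and \<open>\<sim> p \<otimes> t\<close>, which are below \<open>t\<close>.\<close>

lemma boolean_split:
  assumes p: "p \<in> carrier (boolean_algebra_of A)" and u: "u \<in> carrier A" and v: "v \<in> carrier A"
    and eq: "p \<otimes> u = p \<otimes> v" "\<sim> p \<otimes> u = \<sim> p \<otimes> v"
  shows "u = v"
proof -
  have le: "s \<preceq> t" if "s \<in> carrier A" "t \<in> carrier A" "p \<otimes> s = p \<otimes> t" "\<sim> p \<otimes> s = \<sim> p \<otimes> t"
    for s t
  proof -
    have "(p \<^bold>\<or> \<sim> p) \<otimes> s \<preceq> t"
      using that p by (intro mult_join_le) (auto simp: mult_le2)
    then show ?thesis
      using that p by (simp add: boolean_carrier)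
  qed
  show ?thesis
    using le[OF u v] le[OF v u] eq u v by (simp add: le_antisym)
qed

text \<open>The assumptions on \<open>x, y\<close> and \<open>x', y'\<close> are symmetric, so a
  single inequality, used in both directions, yields the equality.\<close>

lemma boolean_localI:
  assumes cl: "\<And>x y. x \<in> carrier A \<Longrightarrow> y \<in> carrier A \<Longrightarrow> g x y \<in> carrier A"
    and le: "\<And>p x y x' y'. \<lbrakk>p \<in> carrier (boolean_algebra_of A); x \<in> carrier A; y \<in> carrier A;
      x' \<in> carrier A; y' \<in> carrier A; p \<otimes> x = p \<otimes> x'; p \<otimes> y = p \<otimes> y'\<rbrakk>
      \<Longrightarrow> p \<otimes> g x y \<preceq> g x' y'"
  shows "boolean_local g"
  unfolding boolean_local_def
proof (intro conjI ballI impI)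
  fix p x y x' y'
  assume "p \<in> carrier (boolean_algebra_of A)" "x \<in> carrier A" "y \<in> carrier A"
    "x' \<in> carrier A" "y' \<in> carrier A" "p \<otimes> x = p \<otimes> x'" "p \<otimes> y = p \<otimes> y'"
  then show "p \<otimes> g x y = p \<otimes> g x' y'"
    using le[of p x y x' y'] le[of p x' y' x y] by (intro boolean_mult_eqI cl) simp_all
qed (rule cl)

lemma boolean_localD:
  assumes "boolean_local g" "p \<in> carrier (boolean_algebra_of A)"
    "x \<in> carrier A" "y \<in> carrier A" "x' \<in> carrier A" "y' \<in> carrier A"
    "p \<otimes> x = p \<otimes> x'" "p \<otimes> y = p \<otimes> y'"
  shows "p \<otimes> g x y = p \<otimes> g x' y'"
  using assms unfolding boolean_local_def by blast

lemma boolean_local_closed: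
  "\<lbrakk>boolean_local g; x \<in> carrier A; y \<in> carrier A\<rbrakk> \<Longrightarrow> g x y \<in> carrier A"
  unfolding boolean_local_def by blast

lemma boolean_local_meet: "boolean_local (\<^bold>\<and>)"
proof (rule boolean_localI)
  fix p x y x' y'
  assume c: "p \<in> carrier (boolean_algebra_of A)" "x \<in> carrier A" "y \<in> carrier A"
    "x' \<in> carrier A" "y' \<in> carrier A" and eq: "p \<otimes> x = p \<otimes> x'" "p \<otimes> y = p \<otimes> y'"
  have "p \<otimes> (x \<^bold>\<and> y) \<preceq> p \<otimes> x'" "p \<otimes> (x \<^bold>\<and> y) \<preceq> p \<otimes> y'"
    unfolding eq[symmetric] using c by (simp_all add: meet_le1 meet_le2 mult_mono2)
  then have "p \<otimes> (x \<^bold>\<and> y) \<preceq> x'" "p \<otimes> (x \<^bold>\<and> y) \<preceq> y'"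
    using c by (meson boolean_closed le_trans m_closed meet_closed mult_le2)+
  then show "p \<otimes> (x \<^bold>\<and> y) \<preceq> x' \<^bold>\<and> y'"
    using c by (simp add: le_meet)
qed auto

text \<open>Residuation lets the factor \<open>p\<close> be tested on each joinand separately, and
  there \<open>x\<close> and \<open>y\<close> may be traded for \<open>x'\<close> and
  \<open>y'\<close>.\<close>

lemma boolean_local_join: "boolean_local (\<^bold>\<or>)"
proof (rule boolean_localI)
  fix p x y x' y'
  assume c: "p \<in> carrier (boolean_algebra_of A)" "x \<in> carrier A" "y \<in> carrier A"
    "x' \<in> carrier A" "y' \<in> carrier A" and eq: "p \<otimes> x = p \<otimes> x'" "p \<otimes> y = p \<otimes> y'"
  have "p \<otimes> x' \<preceq> x' \<^bold>\<or> y'" "p \<otimes> y' \<preceq> x' \<^bold>\<or> y'"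
    using c by (meson boolean_closed join_closed le_join1 le_join2 le_trans m_closed mult_le2)+
  then have "(x \<^bold>\<or> y) \<otimes> p \<preceq> x' \<^bold>\<or> y'"
    using c eq by (intro mult_join_le) (simp_all add: m_comm[of _ p])
  then show "p \<otimes> (x \<^bold>\<or> y) \<preceq> x' \<^bold>\<or> y'"
    using c by (simp add: m_comm)
qed auto

lemma boolean_local_impl: "boolean_local (\<rightharpoonup>)"
proof (rule boolean_localI)
  fix p x y x' y'
  assume c: "p \<in> carrier (boolean_algebra_of A)" "x \<in> carrier A" "y \<in> carrier A"
    "x' \<in> carrier A" "y' \<in> carrier A" and eq: "p \<otimes> x = p \<otimes> x'" "p \<otimes> y = p \<otimes> y'"
  \<comment> \<open>By residuation the goal is a bound on the product with \<open>x'\<close>. Moving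
    \<open>p\<close> next to \<open>x'\<close> turns \<open>x'\<close> into \<open>x\<close>; modus
    ponens then produces \<open>p \<otimes> y\<close>, which is
    \<open>p \<otimes> y'\<close>.\<close>
  have "p \<otimes> (x \<rightharpoonup> y) \<otimes> x' = (x \<rightharpoonup> y) \<otimes> (p \<otimes> x')"
    using c by (simp add: m_ac)
  also have "\<dots> = p \<otimes> ((x \<rightharpoonup> y) \<otimes> x)"
    unfolding eq[symmetric] using c by (simp add: m_ac)
  finally have "p \<otimes> (x \<rightharpoonup> y) \<otimes> x' \<preceq> p \<otimes> y'"
    unfolding eq[symmetric] using c by (simp add: modus_ponens mult_mono2)
  then have "p \<otimes> (x \<rightharpoonup> y) \<otimes> x' \<preceq> y'"
    using c by (meson boolean_closed impl_closed le_trans m_closed mult_le2)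
  then show "p \<otimes> (x \<rightharpoonup> y) \<preceq> x' \<rightharpoonup> y'"
    using c by (simp add: residuation)
qed auto

text \<open>A dense factor cancels below bottom because \<open>d\<close> implies only bottom, so
  \<open>b \<otimes> d\<close> and \<open>b\<close> have the same negation. Hence the Boolean factor
  is determined by the product.\<close>

lemma neg_neg_boolean_mult_dense:
  assumes b: "b \<in> carrier (boolean_algebra_of A)" and d: "d \<in> carrier (dense_algebra A)"
  shows "\<sim> (\<sim> (b \<otimes> d)) = b"
proof -
  have "\<sim> (b \<otimes> d) \<otimes> b \<otimes> d \<preceq> \<^bold>\<bottom>"
    using b d by (simp add: m_assoc neg_mult le_refl)
  then have "\<sim> (b \<otimes> d) \<otimes> b \<preceq> \<^bold>\<bottom>"
    using b d by (simp add: residuation neg_dense)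
  then have "\<sim> (b \<otimes> d) \<preceq> \<sim> b"
    using b d by (simp add: le_neg_iff)
  moreover have "\<sim> b \<preceq> \<sim> (b \<otimes> d)"
    using b d by (simp add: neg_antimono mult_le1)
  ultimately have "\<sim> (b \<otimes> d) = \<sim> b"
    using b d by (simp add: le_antisym)
  then show ?thesis
    using b by (simp add: boolean_neg_neg)
qed

end

section \<open>Boolean and dense factors in Stonean algebras\<close>

context stonean_residuated_lattice
begin

text \<open>Double negations are Boolean here, so it suffices that \<open>b \<otimes> c\<close> is
  its own double negation. That double negation lies below \<open>b\<close> and \<open>c\<close>,
  hence below their meet, which is \<open>b \<otimes> c\<close>.\<close>

lemma boolean_mult:
  assumes b: "b \<in> carrier (boolean_algebra_of A)" and c: "c \<in> carrier (boolean_algebra_of A)"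
  shows "b \<otimes> c \<in> carrier (boolean_algebra_of A)"
proof -
  let ?n = "\<sim> (\<sim> (b \<otimes> c))"
  have "?n \<preceq> \<sim> (\<sim> b)" "?n \<preceq> \<sim> (\<sim> c)"
    using b c by (simp_all add: neg_antimono mult_le1 mult_le2)
  then have "?n \<preceq> b \<otimes> c"
    using b c by (simp add: boolean_neg_neg boolean_mult_eq_meet le_meet)
  then have "?n = b \<otimes> c"
    using b c by (simp add: le_antisym le_neg_neg)
  then show ?thesis
    using boolean_neg_neg_closed[of "b \<otimes> c"] b c by simp
qed

lemma obtain_dense_decomposition:
  assumes "x \<in> carrier A"
  obtains b d where "b \<in> carrier (boolean_algebra_of A)" "d \<in> carrier (dense_algebra A)"
    "x = b \<otimes> d"
  using that[OF boolean_neg_neg_closed dense_decomposition] assms by simp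

end

section \<open>The lifted map and its multiplicativity\<close>

locale stonean_triple_hom =
  dom: stonean_residuated_lattice A1 + cod: stonean_residuated_lattice A2
  for A1 :: "('a, 'm) bounded_res_lattice_scheme" and A2 :: "('b, 'n) bounded_res_lattice_scheme" +
  fixes h k :: "'a \<Rightarrow> 'b"
  assumes hom: "(h, k) \<in> triple_hom (triple_of A1) (triple_of A2)"
begin

abbreviation lift :: "'a \<Rightarrow> 'b"
  where "lift \<equiv> triple_hom_lift A1 A2 h k"

lemma h_hom: "h \<in> bool_alg_hom (boolean_algebra_of A1) (boolean_algebra_of A2)"
  and k_hom: "k \<in> res_lattice_hom (dense_algebra A1) (dense_algebra A2)"
  using hom by (auto simp: triple_of_def)

lemma h_boolean [simp]:
  "b \<in> carrier (boolean_algebra_of A1) \<Longrightarrow> h b \<in> carrier (boolean_algebra_of A2)"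
  using h_hom by (auto simp: bool_alg_hom_def)

lemma k_dense [simp]: "d \<in> carrier (dense_algebra A1) \<Longrightarrow> k d \<in> carrier (dense_algebra A2)"
  using k_hom by (auto simp: res_lattice_hom_def)

lemma h_bot: "h \<^bold>\<bottom>\<^bsub>A1\<^esub> = \<^bold>\<bottom>\<^bsub>A2\<^esub>" and h_one: "h \<one>\<^bsub>A1\<^esub> = \<one>\<^bsub>A2\<^esub>"
  using h_hom by (simp_all add: bool_alg_hom_def boolean_algebra_of_ops)

lemma h_neg: "b \<in> carrier (boolean_algebra_of A1) \<Longrightarrow> h (\<sim>\<^bsub>A1\<^esub> b) = \<sim>\<^bsub>A2\<^esub> (h b)"
  using h_hom by (simp add: bool_alg_hom_def boolean_algebra_of_ops)

text \<open>A Boolean homomorphism speaks of meets only; on Boolean elements these are products in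
  both algebras.\<close>

lemma h_mult:
  assumes "b \<in> carrier (boolean_algebra_of A1)" "c \<in> carrier (boolean_algebra_of A1)"
  shows "h (b \<otimes>\<^bsub>A1\<^esub> c) = h b \<otimes>\<^bsub>A2\<^esub> h c"
proof -
  have "h (b \<^bold>\<and>\<^bsub>A1\<^esub> c) = h b \<^bold>\<and>\<^bsub>A2\<^esub> h c"
    using h_hom assms by (simp add: bool_alg_hom_def boolean_algebra_of_ops)
  then show ?thesis
    using assms by (simp add: dom.boolean_mult_eq_meet cod.boolean_mult_eq_meet)
qed

lemma k_one: "k \<one>\<^bsub>A1\<^esub> = \<one>\<^bsub>A2\<^esub>"
  using k_hom by (simp add: res_lattice_hom_def dense_algebra_ops)

lemma k_ops:
  assumes "d \<in> carrier (dense_algebra A1)" "e \<in> carrier (dense_algebra A1)"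
  shows "k (d \<otimes>\<^bsub>A1\<^esub> e) = k d \<otimes>\<^bsub>A2\<^esub> k e"
    and "k (d \<rightharpoonup>\<^bsub>A1\<^esub> e) = k d \<rightharpoonup>\<^bsub>A2\<^esub> k e"
    and "k (d \<^bold>\<or>\<^bsub>A1\<^esub> e) = k d \<^bold>\<or>\<^bsub>A2\<^esub> k e"
    and "k (d \<^bold>\<and>\<^bsub>A1\<^esub> e) = k d \<^bold>\<and>\<^bsub>A2\<^esub> k e"
  using k_hom assms by (simp_all add: res_lattice_hom_def dense_algebra_ops)

lemma dense_ops:
  assumes "d \<in> carrier (dense_algebra A1)" "e \<in> carrier (dense_algebra A1)"
  shows "d \<rightharpoonup>\<^bsub>A1\<^esub> e \<in> carrier (dense_algebra A1)"
    and "d \<^bold>\<or>\<^bsub>A1\<^esub> e \<in> carrier (dense_algebra A1)"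
    and "d \<^bold>\<and>\<^bsub>A1\<^esub> e \<in> carrier (dense_algebra A1)"
proof -
  interpret D: residuated_lattice "dense_algebra A1"
    by (rule dom.dense_algebra_residuated_lattice)
  show "d \<rightharpoonup>\<^bsub>A1\<^esub> e \<in> carrier (dense_algebra A1)"
    "d \<^bold>\<or>\<^bsub>A1\<^esub> e \<in> carrier (dense_algebra A1)"
    "d \<^bold>\<and>\<^bsub>A1\<^esub> e \<in> carrier (dense_algebra A1)"
    using D.impl_closed[OF assms] D.join_closed[OF assms] D.meet_closed[OF assms]
    by (simp_all add: dense_algebra_ops)
qed

text \<open>The double negation of the product is \<open>b\<close>, so \<open>d\<close> is an
  admissible dense factor and \<open>triple_hom_lift_eq\<close> evaluates the description at
  it.\<close>

lemma lift_boolean_mult_dense: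
  assumes "b \<in> carrier (boolean_algebra_of A1)" "d \<in> carrier (dense_algebra A1)"
  shows "lift (b \<otimes>\<^bsub>A1\<^esub> d) = h b \<otimes>\<^bsub>A2\<^esub> k d"
  using triple_hom_lift_eq[OF dom.stonean_residuated_lattice_axioms
      cod.stonean_residuated_lattice_axioms hom, of "b \<otimes>\<^bsub>A1\<^esub> d" d] assms
  by (simp add: dom.neg_neg_boolean_mult_dense)

lemma lift_boolean: "b \<in> carrier (boolean_algebra_of A1) \<Longrightarrow> lift b = h b"
  using lift_boolean_mult_dense[of b "\<one>\<^bsub>A1\<^esub>"] by (simp add: k_one)

lemma lift_dense: "d \<in> carrier (dense_algebra A1) \<Longrightarrow> lift d = k d"
  \<comment> \<open>The negation of bottom is \<open>\<one>\<close>, which shows that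
    \<open>\<one>\<close> is Boolean.\<close>
  using lift_boolean_mult_dense[of "\<one>\<^bsub>A1\<^esub>" d] dom.boolean_neg[OF dom.bot_boolean]
  by (simp add: h_one lneg_def)

lemma lift_bot: "lift \<^bold>\<bottom>\<^bsub>A1\<^esub> = \<^bold>\<bottom>\<^bsub>A2\<^esub>"
  by (simp add: lift_boolean h_bot)

lemma lift_one: "lift \<one>\<^bsub>A1\<^esub> = \<one>\<^bsub>A2\<^esub>"
  by (simp add: lift_dense k_one)

lemma lift_closed [simp]:
  assumes "x \<in> carrier A1"
  shows "lift x \<in> carrier A2"
  using assms by (rule dom.obtain_dense_decomposition) (simp add: lift_boolean_mult_dense)

lemma lift_mult:
  assumes x: "x \<in> carrier A1" and y: "y \<in> carrier A1"
  shows "lift (x \<otimes>\<^bsub>A1\<^esub> y) = lift x \<otimes>\<^bsub>A2\<^esub> lift y"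
proof -
  obtain b d where bd: "b \<in> carrier (boolean_algebra_of A1)" "d \<in> carrier (dense_algebra A1)"
    "x = b \<otimes>\<^bsub>A1\<^esub> d"
    using x by (rule dom.obtain_dense_decomposition)
  obtain c e where ce: "c \<in> carrier (boolean_algebra_of A1)" "e \<in> carrier (dense_algebra A1)"
    "y = c \<otimes>\<^bsub>A1\<^esub> e"
    using y by (rule dom.obtain_dense_decomposition)
  \<comment> \<open>Regrouping gives again a Boolean factor times a dense one.\<close>
  have "x \<otimes>\<^bsub>A1\<^esub> y = (b \<otimes>\<^bsub>A1\<^esub> c) \<otimes>\<^bsub>A1\<^esub> (d \<otimes>\<^bsub>A1\<^esub> e)"
    using bd ce by (simp add: dom.m_ac)
  then have "lift (x \<otimes>\<^bsub>A1\<^esub> y) = h (b \<otimes>\<^bsub>A1\<^esub> c) \<otimes>\<^bsub>A2\<^esub> k (d \<otimes>\<^bsub>A1\<^esub> e)"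
    using bd ce by (simp add: lift_boolean_mult_dense dom.boolean_mult dom.dense_mult)
  also have "\<dots> = lift x \<otimes>\<^bsub>A2\<^esub> lift y"
    using bd ce by (simp add: lift_boolean_mult_dense h_mult k_ops cod.m_ac)
  finally show ?thesis .
qed

section \<open>Preservation of the local operations\<close>

lemma lift_local:
  assumes loc: "dom.boolean_local g" "cod.boolean_local g'"
    and p: "p \<in> carrier (boolean_algebra_of A1)"
    and c: "x \<in> carrier A1" "y \<in> carrier A1" "x' \<in> carrier A1" "y' \<in> carrier A1"
    and eq: "p \<otimes>\<^bsub>A1\<^esub> x = p \<otimes>\<^bsub>A1\<^esub> x'" "p \<otimes>\<^bsub>A1\<^esub> y = p \<otimes>\<^bsub>A1\<^esub> y'"
    and pres: "lift (g x' y') = g' (lift x') (lift y')"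
  shows "h p \<otimes>\<^bsub>A2\<^esub> lift (g x y) = h p \<otimes>\<^bsub>A2\<^esub> g' (lift x) (lift y)"
proof -
  \<comment> \<open>Multiplicativity carries equality of localizations at \<open>p\<close> over to
    equality at \<open>h p\<close>. So \<open>x, y\<close> can be replaced by \<open>x', y'\<close>
    on both sides, where \<open>pres\<close> applies.\<close>
  have hp: "h p \<otimes>\<^bsub>A2\<^esub> lift z = lift (p \<otimes>\<^bsub>A1\<^esub> z)" if "z \<in> carrier A1" for z
    using that p by (simp add: lift_mult lift_boolean)
  have "h p \<otimes>\<^bsub>A2\<^esub> lift (g x y) = h p \<otimes>\<^bsub>A2\<^esub> lift (g x' y')"
    using dom.boolean_localD[OF loc(1) p c eq] c
    by (simp add: hp dom.boolean_local_closed[OF loc(1)])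
  also have "\<dots> = h p \<otimes>\<^bsub>A2\<^esub> g' (lift x) (lift y)"
    unfolding pres using p c eq by (intro cod.boolean_localD[OF loc(2)]) (simp_all add: hp)
  finally show ?thesis .
qed

text \<open>With \<open>x = b \<otimes> d\<close>, the element \<open>x\<close> agrees with
  \<open>d\<close> at \<open>b\<close> and with bottom at \<open>\<sim> b\<close>; likewise
  \<open>y\<close> with \<open>e\<close> and bottom at \<open>c\<close> and \<open>\<sim> c\<close>.
  \<open>pres\<close> settles each of the four combinations, and \<open>boolean_split\<close>
  reassembles them.\<close>

lemma lift_boolean_local:
  assumes loc: "dom.boolean_local g" "cod.boolean_local g'"
    and pres: "\<And>u v. \<lbrakk>u \<in> insert \<^bold>\<bottom>\<^bsub>A1\<^esub> (carrier (dense_algebra A1));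
      v \<in> insert \<^bold>\<bottom>\<^bsub>A1\<^esub> (carrier (dense_algebra A1))\<rbrakk> \<Longrightarrow> lift (g u v) = g' (lift u) (lift v)"
    and x: "x \<in> carrier A1" and y: "y \<in> carrier A1"
  shows "lift (g x y) = g' (lift x) (lift y)"
proof -
  obtain b d where bd: "b \<in> carrier (boolean_algebra_of A1)" "d \<in> carrier (dense_algebra A1)"
    "x = b \<otimes>\<^bsub>A1\<^esub> d"
    using x by (rule dom.obtain_dense_decomposition)
  obtain c e where ce: "c \<in> carrier (boolean_algebra_of A1)" "e \<in> carrier (dense_algebra A1)"
    "y = c \<otimes>\<^bsub>A1\<^esub> e"
    using y by (rule dom.obtain_dense_decomposition)
  let ?u = "lift (g x y)" and ?v = "g' (lift x) (lift y)"
  have uv: "?u \<in> carrier A2" "?v \<in> carrier A2"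
    using x y by (simp_all add: dom.boolean_local_closed[OF loc(1)]
        cod.boolean_local_closed[OF loc(2)])
  have piece: "h q \<otimes>\<^bsub>A2\<^esub> (h p \<otimes>\<^bsub>A2\<^esub> ?u) = h q \<otimes>\<^bsub>A2\<^esub> (h p \<otimes>\<^bsub>A2\<^esub> ?v)"
    if p: "p \<in> carrier (boolean_algebra_of A1)" and q: "q \<in> carrier (boolean_algebra_of A1)"
      and d': "d' \<in> insert \<^bold>\<bottom>\<^bsub>A1\<^esub> (carrier (dense_algebra A1))"
      and e': "e' \<in> insert \<^bold>\<bottom>\<^bsub>A1\<^esub> (carrier (dense_algebra A1))"
      and eq: "p \<otimes>\<^bsub>A1\<^esub> x = p \<otimes>\<^bsub>A1\<^esub> d'" "q \<otimes>\<^bsub>A1\<^esub> y = q \<otimes>\<^bsub>A1\<^esub> e'"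
    for p q d' e'
  proof -
    have c: "d' \<in> carrier A1" "e' \<in> carrier A1"
      using d' e' by auto
    \<comment> \<open>The Boolean element \<open>q \<otimes> p\<close> refines both \<open>p\<close>
      and \<open>q\<close>, so both agreements hold at it.\<close>
    have "q \<otimes>\<^bsub>A1\<^esub> p \<otimes>\<^bsub>A1\<^esub> x = q \<otimes>\<^bsub>A1\<^esub> p \<otimes>\<^bsub>A1\<^esub> d'"
      using p q x c eq(1) by (simp add: dom.m_assoc)
    moreover have "q \<otimes>\<^bsub>A1\<^esub> p \<otimes>\<^bsub>A1\<^esub> y = q \<otimes>\<^bsub>A1\<^esub> p \<otimes>\<^bsub>A1\<^esub> e'"
      using p q y c eq(2) dom.m_comm[of q p] by (simp add: dom.m_assoc)
    ultimately have "h (q \<otimes>\<^bsub>A1\<^esub> p) \<otimes>\<^bsub>A2\<^esub> ?u = h (q \<otimes>\<^bsub>A1\<^esub> p) \<otimes>\<^bsub>A2\<^esub> ?v"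
      using p q x y c pres[OF d' e'] by (intro lift_local[OF loc]) (simp_all add: dom.boolean_mult)
    then show ?thesis
      using p q uv by (simp add: h_mult cod.m_assoc)
  qed
  have idem: "r \<otimes>\<^bsub>A1\<^esub> (r \<otimes>\<^bsub>A1\<^esub> z) = r \<otimes>\<^bsub>A1\<^esub> z"
    and ann: "\<sim>\<^bsub>A1\<^esub> r \<otimes>\<^bsub>A1\<^esub> (r \<otimes>\<^bsub>A1\<^esub> z) = \<sim>\<^bsub>A1\<^esub> r \<otimes>\<^bsub>A1\<^esub> \<^bold>\<bottom>\<^bsub>A1\<^esub>"
    if "r \<in> carrier (boolean_algebra_of A1)" "z \<in> carrier (dense_algebra A1)" for r z
    using that
    by (simp_all add: dom.m_assoc[symmetric] dom.boolean_idem dom.neg_mult)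
  \<comment> \<open>With the piece for \<open>x\<close> fixed, the two pieces for \<open>y\<close>
    are glued along \<open>h c\<close>; the final split along \<open>h b\<close> glues those for
    \<open>x\<close>.\<close>
  have part: "h p \<otimes>\<^bsub>A2\<^esub> ?u = h p \<otimes>\<^bsub>A2\<^esub> ?v"
    if p: "p \<in> carrier (boolean_algebra_of A1)"
      and d': "d' \<in> insert \<^bold>\<bottom>\<^bsub>A1\<^esub> (carrier (dense_algebra A1))"
      and eq: "p \<otimes>\<^bsub>A1\<^esub> x = p \<otimes>\<^bsub>A1\<^esub> d'"
    for p d'
  proof (rule cod.boolean_split[of "h c"])
    show "h c \<otimes>\<^bsub>A2\<^esub> (h p \<otimes>\<^bsub>A2\<^esub> ?u) = h c \<otimes>\<^bsub>A2\<^esub> (h p \<otimes>\<^bsub>A2\<^esub> ?v)"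
      using ce idem by (intro piece[OF p _ d' _ eq, of _ e]) simp_all
    have "h (\<sim>\<^bsub>A1\<^esub> c) \<otimes>\<^bsub>A2\<^esub> (h p \<otimes>\<^bsub>A2\<^esub> ?u) = h (\<sim>\<^bsub>A1\<^esub> c) \<otimes>\<^bsub>A2\<^esub> (h p \<otimes>\<^bsub>A2\<^esub> ?v)"
      using ce ann dom.boolean_neg
      by (intro piece[OF p _ d' _ eq, of _ "\<^bold>\<bottom>\<^bsub>A1\<^esub>"]) simp_all
    then show "\<sim>\<^bsub>A2\<^esub> (h c) \<otimes>\<^bsub>A2\<^esub> (h p \<otimes>\<^bsub>A2\<^esub> ?u) = \<sim>\<^bsub>A2\<^esub> (h c) \<otimes>\<^bsub>A2\<^esub> (h p \<otimes>\<^bsub>A2\<^esub> ?v)"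
      using ce by (simp add: h_neg)
  qed (use ce p uv in simp_all)
  show ?thesis
  proof (rule cod.boolean_split[of "h b"])
    show "h b \<otimes>\<^bsub>A2\<^esub> ?u = h b \<otimes>\<^bsub>A2\<^esub> ?v"
      using bd idem by (intro part[of _ d]) simp_all
    have "h (\<sim>\<^bsub>A1\<^esub> b) \<otimes>\<^bsub>A2\<^esub> ?u = h (\<sim>\<^bsub>A1\<^esub> b) \<otimes>\<^bsub>A2\<^esub> ?v"
      using bd ann dom.boolean_neg by (intro part[of _ "\<^bold>\<bottom>\<^bsub>A1\<^esub>"]) simp_all
    then show "\<sim>\<^bsub>A2\<^esub> (h b) \<otimes>\<^bsub>A2\<^esub> ?u = \<sim>\<^bsub>A2\<^esub> (h b) \<otimes>\<^bsub>A2\<^esub> ?v"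
      using bd by (simp add: h_neg)
  qed (use bd uv in simp_all)
qed

lemma lift_meet:
  assumes "x \<in> carrier A1" "y \<in> carrier A1"
  shows "lift (x \<^bold>\<and>\<^bsub>A1\<^esub> y) = lift x \<^bold>\<and>\<^bsub>A2\<^esub> lift y"
  using dom.boolean_local_meet cod.boolean_local_meet _ assms
  by (rule lift_boolean_local) (auto simp: lift_bot lift_dense dense_ops k_ops)

lemma lift_join:
  assumes "x \<in> carrier A1" "y \<in> carrier A1"
  shows "lift (x \<^bold>\<or>\<^bsub>A1\<^esub> y) = lift x \<^bold>\<or>\<^bsub>A2\<^esub> lift y"
  using dom.boolean_local_join cod.boolean_local_join _ assms
  by (rule lift_boolean_local) (auto simp: lift_bot lift_dense dense_ops k_ops)

text \<open>In the mixed cases, bottom implies everything, giving \<open>\<one>\<close>, while a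
  dense element implies bottom only to the degree bottom. The latter holds in both algebras, as
  \<open>k\<close> keeps elements dense.\<close>

lemma lift_impl:
  assumes "x \<in> carrier A1" "y \<in> carrier A1"
  shows "lift (x \<rightharpoonup>\<^bsub>A1\<^esub> y) = lift x \<rightharpoonup>\<^bsub>A2\<^esub> lift y"
  using dom.boolean_local_impl cod.boolean_local_impl _ assms
  by (rule lift_boolean_local)
    (auto simp: lift_bot lift_one lift_dense dense_ops k_ops dom.neg_dense cod.neg_dense)

end

theorem theorem3p10:
  fixes A1 :: "'a bounded_res_lattice" and A2 :: "'b bounded_res_lattice"
    and h k f :: "'a \<Rightarrow> 'b"
  assumes "stonean_residuated_lattice A1" and "stonean_residuated_lattice A2"
    and "(h, k) \<in> triple_hom (triple_of A1) (triple_of A2)"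
    and "\<And>x. x \<in> carrier A1 \<Longrightarrow> f x = triple_hom_lift A1 A2 h k x"
  shows "(\<forall>a\<in>carrier (boolean_algebra_of A1). f a = h a) \<and>
    (\<forall>d\<in>carrier (dense_algebra A1). f d = k d) \<and>
    f \<^bold>\<bottom>\<^bsub>A1\<^esub> = \<^bold>\<bottom>\<^bsub>A2\<^esub> \<and> f \<one>\<^bsub>A1\<^esub> = \<one>\<^bsub>A2\<^esub> \<and>
    (\<forall>x\<in>carrier A1. \<forall>y\<in>carrier A1. f (x \<^bold>\<and>\<^bsub>A1\<^esub> y) = f x \<^bold>\<and>\<^bsub>A2\<^esub> f y) \<and>
    (\<forall>x\<in>carrier A1. \<forall>y\<in>carrier A1. f (x \<otimes>\<^bsub>A1\<^esub> y) = f x \<otimes>\<^bsub>A2\<^esub> f y) \<and>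
    (\<forall>x\<in>carrier A1. \<forall>y\<in>carrier A1. f (x \<rightharpoonup>\<^bsub>A1\<^esub> y) = f x \<rightharpoonup>\<^bsub>A2\<^esub> f y) \<and>
    (\<forall>x\<in>carrier A1. \<forall>y\<in>carrier A1. f (x \<^bold>\<or>\<^bsub>A1\<^esub> y) = f x \<^bold>\<or>\<^bsub>A2\<^esub> f y)"
proof -
  interpret stonean_triple_hom A1 A2 h k
    using assms(1-3) by (simp add: stonean_triple_hom_def stonean_triple_hom_axioms_def)
  show ?thesis
    by (simp add: assms(4) lift_boolean lift_dense lift_bot lift_one lift_meet lift_mult
        lift_impl lift_join)
qed

end
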